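(* Let $K$ be a field of characteristic zero, let $a\in K$, and set $g_a(x)=\frac{1+ax}{1-x^3}\in K[[x]]$. Let $\sum_{n\ge0}\mu_n z^n$ be the central transform of $g_a$, let $h_n=\det(\mu_{i+j})_{0\le i,j\le n}$ for $n\ge 0$, and let $H_{g_a}(x)=\sum_{n\ge0}h_nx^n\in K[[x]]$. Then $$H_{g_a}(x)=\frac{1+(1-a)x+x^2-x^3}{1-(a+1)x+\bigl((a+1)^2-1\bigr)x^2-(a+1)x^3+x^4}.$$ Equivalently, $h_0=1$, $h_1=2$, $h_2=3-a^2$, $h_3=3-3a^2-a^3$, and, for all $n\ge4$, $$h_n=(a+1)h_{n-1}-\bigl((a+1)^2-1\bigr)h_{n-2}+(a+1)h_{n-3}-h_{n-4}.$$
   Context: All power series are formal. For a commutative $\mathbb{Q}$-algebra $R$ and $g(x)\in R[[x]]$ with $g(0)=1$, the central transform of $g$ is the power series $\mathcal{C}(g)(z)=\sum_{n\ge0}\mu_n z^n\in R[[z]]$ with coefficients $$\mu_n=[x^{2n}]\left(\frac{1}{(1-x)\,g\left(\frac{x}{1-x}\right)}\left(\frac{x}{1-x}\right)^n\right),$$ where $[x^{m}]F(x)$ denotes the coefficient of $x^m$ in $F(x)$. *)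

theory Defs
  imports
    "HOL-Computational_Algebra.Formal_Power_Series"
    "Jordan_Normal_Form.Determinant"
begin

text \<open>
  The central transform is meant for series with constant coefficient 1, so that the
  denominator below has constant coefficient 1 and \<open>/\<close> is multiplication by its inverse.
  The coefficient ring is taken to be a field of characteristic 0.
\<close>

definition central_transform :: "'a::field_char_0 fps \<Rightarrow> 'a fps" where
  "central_transform g = Abs_fps (\<lambda>n.
     fps_nth (1 / ((1 - fps_X) * (g oo (fps_X / (1 - fps_X)))) * (fps_X / (1 - fps_X)) ^ n)
       (2 * n))"

text \<open>The index is the largest row index: the matrix has \<open>n + 1\<close> rows, indexed by \<open>0, \<dots>, n\<close>.\<close>

definition hankel_det :: "(nat \<Rightarrow> 'a::comm_ring_1) \<Rightarrow> nat \<Rightarrow> 'a" where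
  "hankel_det \<mu> n = det (mat (n + 1) (n + 1) (\<lambda>(i, j). \<mu> (i + j)))"

definition central_hankel :: "'a::field_char_0 fps \<Rightarrow> nat \<Rightarrow> 'a" where
  "central_hankel g n = hankel_det (fps_nth (central_transform g)) n"

definition central_hankel_series :: "'a::field_char_0 fps \<Rightarrow> 'a fps" where
  "central_hankel_series g = Abs_fps (central_hankel g)"

definition g_series :: "'a::field_char_0 \<Rightarrow> 'a fps" where
  "g_series a = (1 + fps_const a * fps_X) / (1 - fps_X ^ 3)"

end

theory Submission
  imports Defs
begin

text \<open>
  Let \<open>L\<close> be the linear functional on polynomials in \<open>z\<close> with \<open>L(z^n) = \<mu>\<^sub>n\<close>. A Hankel determinant
  does not change when the monomials are replaced by monic polynomials, even by different ones for
  rows and for columns (\<open>hankel_det_eq_det_monic_bases\<close>). The proof chooses two families for which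
  the matrix of values \<open>L(R\<^sub>i Q\<^sub>j)\<close> is the identity minus a matrix of rank one, whose
  determinant is immediate (\<open>det_identity_minus_rank_one\<close>).

  To find them, put \<open>z = s + 2 + 1/s\<close> and \<open>t = z - 2 = s + 1/s\<close>. Expanding the definition,
  \<open>\<mu>\<^sub>n\<close> is the sum over \<open>k\<close> of \<open>c\<^sub>k\<close> times the binomial coefficient \<open>2n\<close> over \<open>n + k\<close>, where
  \<open>c\<^sub>k\<close> is a coefficient of \<open>1/g\<close>. That binomial coefficient is also the coefficient of \<open>s^k\<close> in
  \<open>z^n = (1 + s)^(2n) / s^n\<close>. Hence \<open>L(1) = c\<^sub>0\<close> and \<open>L(s^k + s^(-k)) = c\<^sub>k\<close> for positive \<open>k\<close>
  (\<open>moment_cheb_first\<close>). The polynomials \<open>1, s + 1/s, s^2 + s^(-2), \<dots>\<close> have generating function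
  \<open>(1 - x^2) / (1 - t x + x^2)\<close>, so the polynomials \<open>R\<^sub>i\<close> with generating function
  \<open>(1 - x^2) g(x) / (1 - t x + x^2)\<close> satisfy \<open>L(R\<^sub>0) = 1\<close> and \<open>L(R\<^sub>i) = 0\<close> for \<open>i > 0\<close>
  (\<open>moment_cheb_times_g\<close>). These are the rows.

  The columns have to exploit the special form of \<open>g\<close>. The functional \<open>L\<close> integrates
  against half of \<open>1/g(s) + 1/g(1/s)\<close>, and for \<open>g = (1 + a x) / (1 - x^3)\<close> this sum equals
  \<open>(z - 1) (z - 1 + a) (4 - z) / ((1 + a s) (1 + a/s))\<close>. Apart from the factors \<open>z - 1\<close>
  and \<open>z - (1 - a)\<close> this is a Bernstein-Szego weight, with explicit orthogonal polynomials
  \<open>P\<^sub>k = \<chi>\<^sub>k + a \<chi>\<^bsub>k-1\<^esub>\<close> for \<open>k \<ge> 1\<close>, where \<open>\<chi>\<^sub>k = s^k + \<dots> + s^(-k)\<close>. Following Christoffel, one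
  absorbs the factor \<open>z - 1\<close> in the rows and the factor \<open>z - (1 - a)\<close> in the columns: the polynomials
  \<open>(P\<^bsub>i+1\<^esub>(z) - P\<^bsub>i+1\<^esub>(1)) / (z - 1)\<close> are exactly the \<open>R\<^sub>i\<close>, and \<open>Q\<^sub>j\<close> is the analogous quotient
  at \<open>1 - a\<close>. The rank one term comes from \<open>P\<^bsub>i+1\<^esub>(1) P\<^bsub>j+1\<^esub>(1 - a)\<close>. No orthogonality has to be
  proved: multiplication by \<open>t\<close> acts on both families by a three-term recurrence with constant
  corrections, which determines all \<open>L(R\<^sub>i Q\<^sub>j)\<close> from the values \<open>L(R\<^sub>i)\<close>
  (\<open>gram_matrix_rank_one\<close>).

  The outcome is \<open>h\<^sub>n = 1 - (r\<^sub>1 v\<^sub>0 + \<dots> + r\<^bsub>n+1\<^esub> v\<^sub>n)\<close>, where \<open>r\<close> is periodic with period 3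
  and \<open>v\<close> is a Lucas sequence. Both satisfy recurrences of order two, so their product
  satisfies one of order four; the first values of \<open>h\<close> show that \<open>h\<close> satisfies it as well.
\<close>

section \<open>Hankel determinants in monic bases\<close>

text \<open>
  Border the matrix by the column \<open>u\<close>, the row \<open>v\<close> and a corner entry 1. Eliminating the
  border with the corner entry leaves \<open>I - u v\<^sup>T\<close>, eliminating it with the identity block leaves the
  single entry \<open>1 - v\<^sup>T u\<close>.
\<close>

lemma det_identity_minus_rank_one:
  fixes u v :: "nat \<Rightarrow> 'a :: idom"
  shows "det (mat n n (\<lambda>(i, j). (if i = j then 1 else 0) - u i * v j)) = 1 - (\<Sum>i<n. u i * v i)"
proof -
  define I where "I = (1\<^sub>m n :: 'a mat)"
  define J where "J = (1\<^sub>m 1 :: 'a mat)"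
  define U where "U = mat n 1 (\<lambda>(i, _). u i)"
  define V where "V = mat 1 n (\<lambda>(_, j). v j)"
  define D where "D = mat n n (\<lambda>(i, j). (if i = j then 1 else 0) - u i * v j)"
  define e where "e = mat 1 1 (\<lambda>_. 1 - (\<Sum>i<n. u i * v i))"
  note defs = I_def J_def U_def V_def D_def e_def
  have c: "I \<in> carrier_mat n n" "J \<in> carrier_mat 1 1" "U \<in> carrier_mat n 1"
    "V \<in> carrier_mat 1 n" "D \<in> carrier_mat n n" "e \<in> carrier_mat 1 1"
    "0\<^sub>m n 1 \<in> carrier_mat n 1" "0\<^sub>m 1 n \<in> carrier_mat 1 n"
    by (auto simp: defs)
  have D: "D * I + U * V = I"
    by (rule eq_matI) (auto simp: defs scalar_prod_def)
  have e: "V * U + J * e = J"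
    by (rule eq_matI)
       (auto simp: defs scalar_prod_def lessThan_atLeast0 mult.commute)
  have "four_block_mat D U (0\<^sub>m 1 n) J * four_block_mat I (0\<^sub>m n 1) V J
      = four_block_mat I U V J"
    using c by (subst mult_four_block_mat[where ?nr1.0 = n and ?n1.0 = n and ?n2.0 = 1 and ?nr2.0 = 1 and ?nc1.0 = n and ?nc2.0 = 1]) (auto simp: D, auto simp: defs)
  moreover have "four_block_mat I (0\<^sub>m n 1) V J * four_block_mat I U (0\<^sub>m 1 n) e
      = four_block_mat I U V J"
    using c by (subst mult_four_block_mat[where ?nr1.0 = n and ?n1.0 = n and ?n2.0 = 1 and ?nr2.0 = 1 and ?nc1.0 = n and ?nc2.0 = 1]) (auto simp: e, auto simp: defs)
  ultimately have "det (four_block_mat D U (0\<^sub>m 1 n) J * four_block_mat I (0\<^sub>m n 1) V J)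
      = det (four_block_mat I (0\<^sub>m n 1) V J * four_block_mat I U (0\<^sub>m 1 n) e)"
    by simp
  moreover have "det (four_block_mat D U (0\<^sub>m 1 n) J) = det D"
    using det_four_block_mat_lower_left_zero[OF c(5,3) refl c(2)] by (simp add: J_def)
  moreover have "det (four_block_mat I U (0\<^sub>m 1 n) e) = det e"
    using det_four_block_mat_lower_left_zero[OF c(1,3) refl c(6)] by (simp add: I_def)
  moreover have "det (four_block_mat I (0\<^sub>m n 1) V J) = 1"
    using det_four_block_mat_upper_right_zero[OF c(1) refl c(4,2)] by (simp add: I_def J_def)
  ultimately have "det D = det e"
    using det_mult[OF four_block_carrier_mat[OF c(5,2)] four_block_carrier_mat[OF c(1,2)]]
      det_mult[OF four_block_carrier_mat[OF c(1,2)] four_block_carrier_mat[OF c(1,6)]]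
    by simp
  then show ?thesis
    by (simp add: D_def e_def det_single)
qed
definition moment :: "(nat \<Rightarrow> 'a::comm_ring_1) \<Rightarrow> 'a poly \<Rightarrow> 'a" where
  "moment \<mu> p = (\<Sum>i\<le>degree p. coeff p i * \<mu> i)"

lemma moment_eq_sum:
  assumes "degree p \<le> N"
  shows "moment \<mu> p = (\<Sum>i\<le>N. coeff p i * \<mu> i)"
  unfolding moment_def
  by (rule sum.mono_neutral_left) (use assms in \<open>auto simp: coeff_eq_0\<close>)

lemma moment_add: "moment \<mu> (p + q) = moment \<mu> p + moment \<mu> q"
proof -
  define N where "N = max (degree p) (degree q)"
  have "degree (p + q) \<le> N" "degree p \<le> N" "degree q \<le> N"
    by (auto simp: N_def degree_add_le)
  then show ?thesis
    by (simp add: moment_eq_sum[of _ N] sum.distrib algebra_simps)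
qed

lemma moment_smult: "moment \<mu> (smult r p) = r * moment \<mu> p"
  using moment_eq_sum[OF degree_smult_le, of \<mu> r p]
  by (simp add: moment_def sum_distrib_left mult.assoc)

lemma moment_0 [simp]: "moment \<mu> 0 = 0"
  by (simp add: moment_def)

lemma moment_diff: "moment \<mu> (p - q) = moment \<mu> p - moment \<mu> q"
  using moment_add[of \<mu> "p - q" q] by simp

lemma moment_sum: "moment \<mu> (sum p A) = (\<Sum>i\<in>A. moment \<mu> (p i))"
  by (induction A rule: infinite_finite_induct) (auto simp: moment_add)

lemma moment_monom [simp]: "moment \<mu> (monom 1 n) = \<mu> n"
  by (simp add: moment_eq_sum[OF degree_monom_le] if_distrib[where f = "\<lambda>x. x * _"] sum.delta
        cong: if_cong)

text \<open>
  The two matrices differ by factors that hold the coefficients of the bases: triangular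
  matrices with ones on the diagonal.
\<close>

lemma hankel_det_eq_det_monic_bases:
  fixes p q :: "nat \<Rightarrow> 'a :: idom poly"
  assumes p: "\<And>i. degree (p i) \<le> i" "\<And>i. coeff (p i) i = 1"
    and q: "\<And>i. degree (q i) \<le> i" "\<And>i. coeff (q i) i = 1"
  shows "hankel_det \<mu> n = det (mat (n + 1) (n + 1) (\<lambda>(i, j). moment \<mu> (p i * q j)))"
proof -
  define A where "A = mat (n + 1) (n + 1) (\<lambda>(i, k). coeff (p i) k)"
  define B where "B = mat (n + 1) (n + 1) (\<lambda>(i, k). coeff (q i) k)"
  define H where "H = mat (n + 1) (n + 1) (\<lambda>(i, j). \<mu> (i + j))"
  have c: "A \<in> carrier_mat (n + 1) (n + 1)" "B \<in> carrier_mat (n + 1) (n + 1)"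
    "H \<in> carrier_mat (n + 1) (n + 1)"
    by (auto simp: A_def B_def H_def)
  have "det A = prod_list (diag_mat A)"
    by (rule det_lower_triangular[OF _ c(1)]) (auto simp: A_def intro!: coeff_eq_0 le_less_trans[OF p(1)])
  also have "diag_mat A = replicate (n + 1) 1"
    by (rule nth_equalityI) (auto simp: A_def diag_mat_def p(2) nth_replicate simp del: upt_Suc replicate_Suc)
  finally have detA: "det A = 1" by simp
  have "det B = prod_list (diag_mat B)"
    by (rule det_lower_triangular[OF _ c(2)]) (auto simp: B_def intro!: coeff_eq_0 le_less_trans[OF q(1)])
  also have "diag_mat B = replicate (n + 1) 1"
    by (rule nth_equalityI) (auto simp: B_def diag_mat_def q(2) nth_replicate simp del: upt_Suc replicate_Suc)
  finally have detB: "det B = 1" by simp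
  have expand: "r = (\<Sum>k\<le>n. smult (coeff r k) (monom 1 k))" if "degree r \<le> n" for r :: "'a poly"
    using poly_as_sum_of_monoms'[OF that] by (simp add: smult_monom)
  have entry: "moment \<mu> (p i * q j) = (A * H * transpose_mat B) $$ (i, j)" if "i < n + 1" "j < n + 1" for i j
  proof -
    have "moment \<mu> (p i * q j) = moment \<mu> ((\<Sum>k\<le>n. smult (coeff (p i) k) (monom 1 k)) * (\<Sum>l\<le>n. smult (coeff (q j) l) (monom 1 l)))"
      using that p(1)[of i] q(1)[of j] by (subst (1 2) expand) auto
    also have "\<dots> = (\<Sum>k\<le>n. \<Sum>l\<le>n. coeff (p i) k * \<mu> (k + l) * coeff (q j) l)"
      by (simp add: sum_product moment_sum moment_smult mult_monom ac_simps)
    also have "\<dots> = (\<Sum>l\<le>n. (\<Sum>k\<le>n. coeff (p i) k * \<mu> (k + l)) * coeff (q j) l)"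
      by (subst sum.swap) (simp add: sum_distrib_right)
    also have "\<dots> = (A * H * transpose_mat B) $$ (i, j)"
      using that by (simp add: A_def B_def H_def scalar_prod_def atLeast0LessThan lessThan_Suc_atMost)
    finally show ?thesis .
  qed
  then have "mat (n + 1) (n + 1) (\<lambda>(i, j). moment \<mu> (p i * q j)) = A * H * transpose_mat B"
  proof (intro eq_matI)
    fix i j assume "i < dim_row (A * H * transpose_mat B)" "j < dim_col (A * H * transpose_mat B)"
    then have "i < n + 1" "j < n + 1" using c by auto
    moreover from this have "mat (n + 1) (n + 1) (\<lambda>(i, j). moment \<mu> (p i * q j)) $$ (i, j)
        = moment \<mu> (p i * q j)" by simp
    ultimately show "mat (n + 1) (n + 1) (\<lambda>(i, j). moment \<mu> (p i * q j)) $$ (i, j)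
        = (A * H * transpose_mat B) $$ (i, j)"
      using entry by metis
  qed (use c in auto)
  then have "det (mat (n + 1) (n + 1) (\<lambda>(i, j). moment \<mu> (p i * q j))) = det A * det H * det B"
    using c by (simp add: det_mult[where n = "n + 1"] det_transpose)
  then show ?thesis
    by (simp add: detA detB H_def hankel_det_def)
qed

section \<open>Chebyshev recurrences with a source term\<close>

text \<open>
  These are the coefficients of \<open>f(x) / (1 - t x + x^2)\<close> with \<open>t = z - 2\<close>. For \<open>f = 1\<close> they are
  the Chebyshev polynomials of the second kind in \<open>t/2\<close>. The shift by 2 makes them polynomials in
  \<open>z = s + 2 + 1/s\<close>, the variable whose powers have the moments \<open>\<mu>\<^sub>n\<close>.
\<close>

fun cheb :: "'a::comm_ring_1 fps \<Rightarrow> nat \<Rightarrow> 'a poly" where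
  "cheb f 0 = [:fps_nth f 0:]"
| "cheb f (Suc n) =
     [:-2, 1:] * cheb f n - (if n = 0 then 0 else cheb f (n - 1)) + [:fps_nth f (Suc n):]"

lemma degree_cheb_le: "degree (cheb f n) \<le> n"
proof (induction n rule: less_induct)
  case (less n)
  show ?case
  proof (cases n)
    case (Suc m)
    have "degree ([:-2, 1:] * cheb f m) \<le> degree [:-2, 1 :: 'a:] + degree (cheb f m)"
      by (rule degree_mult_le)
    also have "\<dots> \<le> n" using less[of m] Suc by simp
    finally have "degree ([:-2, 1:] * cheb f m) \<le> n" .
    moreover have "degree (if m = 0 then 0 else cheb f (m - 1)) \<le> n"
      using less[of "m - 1"] Suc by (cases m) auto
    ultimately show ?thesis
      unfolding Suc cheb.simps using Suc by (intro degree_add_le degree_diff_le) auto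
  qed simp
qed

lemma lead_coeff_cheb: "coeff (cheb f n) n = fps_nth f 0"
proof (induction n)
  case (Suc n)
  have "coeff (cheb f n) (Suc n) = 0"
    by (rule coeff_eq_0) (use degree_cheb_le[of f n] in simp)
  moreover have "coeff (cheb f (n - 1)) (Suc n) = 0"
    by (rule coeff_eq_0) (use degree_cheb_le[of f "n - 1"] in simp)
  ultimately show ?case
    using Suc by simp
qed simp

text \<open>
  The source term is a constant, so up to constants multiplication by \<open>t\<close> is the same shift
  operator for every \<open>f\<close>.
\<close>

lemma mult_cheb:
  "[:-2, 1:] * cheb f n =
     cheb f (Suc n) + (if n = 0 then 0 else cheb f (n - 1)) - [:fps_nth f (Suc n):]"
  by simp

text \<open>
  On generating functions this is the identity of \<open>(f g) / (1 - t x + x^2)\<close> and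
  \<open>g (f / (1 - t x + x^2))\<close>.
\<close>

lemma cheb_mult:
  "cheb (f * g) n = (\<Sum>j\<le>n. smult (fps_nth g j) (cheb f (n - j)))"
proof (induction n rule: less_induct)
  case (less n)
  define C where "C m = (\<Sum>j\<le>m. smult (fps_nth g j) (cheb f (m - j)))" for m
  have IH: "cheb (f * g) m = C m" if "m < n" for m
    using less[OF that] by (simp add: C_def)
  have const: "[:fps_nth (f * g) m:] = (\<Sum>j\<le>m. smult (fps_nth g j) [:fps_nth f (m - j):])" for m
    by (subst mult.commute[of f], rule poly_eqI)
       (simp add: fps_mult_nth atLeast0AtMost coeff_sum coeff_pCons split: nat.split)
  consider "n = 0" | "n = 1" | m where "n = Suc (Suc m)"
    by (cases n; cases "n - 1") auto
  then have "cheb (f * g) n = C n"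
  proof cases
    case 1
    then show ?thesis using const[of 0] by (simp add: C_def)
  next
    case 2
    then show ?thesis using const[of 1] IH[of 0]
      by (simp add: C_def algebra_simps)
  next
    case (3 m)
    have "C (Suc (Suc m)) = (\<Sum>j\<le>m. smult (fps_nth g j) (cheb f (Suc (Suc (m - j)))))
        + smult (fps_nth g (Suc m)) (cheb f 1) + smult (fps_nth g (Suc (Suc m))) (cheb f 0)"
      by (simp add: C_def Suc_diff_le del: cheb.simps)
    moreover have "C (Suc m) = (\<Sum>j\<le>m. smult (fps_nth g j) (cheb f (Suc (m - j))))
        + smult (fps_nth g (Suc m)) (cheb f 0)"
      by (simp add: C_def Suc_diff_le del: cheb.simps)
    moreover have "[:fps_nth (f * g) (Suc (Suc m)):] =
        (\<Sum>j\<le>m. smult (fps_nth g j) [:fps_nth f (Suc (Suc (m - j))):])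
        + smult (fps_nth g (Suc m)) [:fps_nth f 1:] + smult (fps_nth g (Suc (Suc m))) [:fps_nth f 0:]"
      unfolding const by (simp add: Suc_diff_le)
    moreover have "(\<Sum>j\<le>m. smult (fps_nth g j) (cheb f (Suc (Suc (m - j))))) =
       [:-2, 1:] * (\<Sum>j\<le>m. smult (fps_nth g j) (cheb f (Suc (m - j)))) - C m
        + (\<Sum>j\<le>m. smult (fps_nth g j) [:fps_nth f (Suc (Suc (m - j))):])"
      unfolding C_def sum_distrib_left sum_subtractf[symmetric] sum.distrib[symmetric]
      by (rule sum.cong[OF refl], subst (1) cheb.simps(2)) (simp only: nat.simps if_False diff_Suc_1 smult_add_right smult_diff_right mult_smult_right)
    moreover have "cheb (f * g) n = [:-2, 1:] * C (Suc m) - C m + [:fps_nth (f * g) (Suc (Suc m)):]"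
      unfolding 3 by (subst cheb.simps(2)) (use 3 IH[of m] IH[of "Suc m"] in \<open>simp del: cheb.simps\<close>)
    moreover have "cheb f 1 = [:-2, 1:] * cheb f 0 + [:fps_nth f 1:]"
      by simp
    moreover have "cheb f 0 = [:fps_nth f 0:]"
      by simp
    ultimately have "cheb (f * g) (Suc (Suc m)) + C m = C (Suc (Suc m)) + C m"
      unfolding 3 by (simp only: algebra_simps smult_add_right mult_smult_right)
    then show ?thesis
      unfolding 3 by (simp only: add_right_cancel)
  qed
  then show ?case by (simp only: C_def)
qed

section \<open>The central transform as a moment sequence\<close>

text \<open>
  With \<open>z = s + 2 + 1/s\<close> these are 1 and \<open>s^k + s^(-k)\<close> for \<open>k > 0\<close>: twice the Chebyshev
  polynomials of the first kind in \<open>t/2\<close>, except that the member of index 0 is halved.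
\<close>

definition cheb_first :: "nat \<Rightarrow> 'a::comm_ring_1 poly" where
  "cheb_first = cheb (1 - fps_X ^ 2)"

lemma cheb_first_simps:
  "cheb_first 0 = (1 :: 'a::comm_ring_1 poly)"
  "[:0, 1:] * cheb_first 0 = cheb_first 1 + smult 2 (cheb_first 0 :: 'a poly)"
  "[:0, 1:] * (cheb_first (Suc k) :: 'a poly) = cheb_first (Suc (Suc k)) + smult 2 (cheb_first (Suc k))
     + (if k = 0 then 2 else cheb_first k)"
proof -
  have eq: "[:0, 1:] * p = [:-2, 1:] * p + smult 2 p" for p :: "'a poly"
    by simp
  show "cheb_first 0 = (1 :: 'a poly)" by (simp add: cheb_first_def)
  show "[:0, 1:] * cheb_first 0 = cheb_first 1 + smult 2 (cheb_first 0 :: 'a poly)"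
    by (simp add: cheb_first_def)
  show "[:0, 1:] * cheb_first (Suc k) = cheb_first (Suc (Suc k)) + smult 2 (cheb_first (Suc k))
     + (if k = 0 then 2 else cheb_first k :: 'a poly)"
    unfolding cheb_first_def eq mult_cheb by (auto simp: numeral_poly)
qed

text \<open>
  This is the expansion of \<open>z^n = (1 + s)^(2n) / s^n\<close> by the binomial theorem, with the terms of
  exponents \<open>k\<close> and \<open>-k\<close> collected. It is proved without \<open>s\<close>, by applying Pascal's rule twice.
\<close>

lemma monom_eq_sum_cheb_first:
  "monom 1 n = (\<Sum>k\<le>n. smult (of_nat (2 * n choose (n + k))) (cheb_first k :: 'a::comm_ring_1 poly))"
proof (induction n)
  case 0
  show ?case by (simp add: cheb_first_simps)
next
  case (Suc n)
  define T where "T = (cheb_first :: nat \<Rightarrow> 'a poly)"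
  define b where "b k = (of_nat (2 * n choose (n + k)) :: 'a)" for k
  have b0: "b k = 0" if "k > n" for k
    using that by (simp add: b_def binomial_eq_0)
  have pascal: "of_nat (2 * Suc n choose (Suc n + Suc k)) = b k + 2 * b (Suc k) + b (Suc (Suc k))" for k
    by (simp add: b_def numeral_2_eq_2)
  \<comment> \<open>At \<open>k = 0\<close> Pascal's rule produces the term of index \<open>-1\<close>, which symmetry identifies with that of index 1.\<close>
  have pascal0: "of_nat (2 * Suc n choose Suc n) = 2 * b 0 + 2 * b 1"
  proof (cases n)
    case (Suc m)
    have "2 * n choose m = 2 * n choose (Suc n)"
      using binomial_symmetric[of m "2 * n"] Suc by simp
    then show ?thesis using Suc by (simp add: b_def numeral_2_eq_2)
  qed (simp add: b_def)
  have shift: "(\<Sum>k\<le>n. smult (b k) (F k)) = smult (b 0) (F 0) + (\<Sum>k\<le>n. smult (b (Suc k)) (F (Suc k)))"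
    for F :: "nat \<Rightarrow> 'a poly"
    using sum.atMost_Suc_shift[of "\<lambda>k. smult (b k) (F k)" n] by (simp add: b0)
  have "monom 1 (Suc n) = [:0, 1:] * (\<Sum>k\<le>n. smult (b k) (T k))"
    using Suc by (simp add: monom_Suc b_def T_def)
  also have "\<dots> = (\<Sum>k\<le>n. smult (b k) ([:0, 1:] * T k))"
    by (simp only: sum_distrib_left mult_smult_right)
  \<comment> \<open>The last sum holds the lower neighbours in \<open>z T\<^sub>k\<close>: none for \<open>k = 0\<close>, and doubled for \<open>k = 1\<close> because \<open>T\<^sub>0\<close> is halved.\<close>
  also have "\<dots> = (\<Sum>k\<le>n. smult (b k) (T (Suc k))) + (\<Sum>k\<le>n. smult (2 * b k) (T k))
      + (\<Sum>k\<le>n. smult (b k) (case k of 0 \<Rightarrow> 0 | Suc 0 \<Rightarrow> 2 | Suc (Suc l) \<Rightarrow> T (Suc l)))"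
    unfolding sum.distrib[symmetric]
  proof (rule sum.cong[OF refl])
    fix k
    show "smult (b k) ([:0, 1:] * T k) = smult (b k) (T (Suc k)) + smult (2 * b k) (T k)
      + smult (b k) (case k of 0 \<Rightarrow> 0 | Suc 0 \<Rightarrow> 2 | Suc (Suc l) \<Rightarrow> T (Suc l))"
    proof (cases k)
      case 0
      then show ?thesis using cheb_first_simps(2)[where 'a='a]
        by (simp only: T_def smult_add_right smult_smult mult.commute nat.case) simp
    next
      case (Suc l)
      then show ?thesis using cheb_first_simps(3)[of l, where 'a='a]
        by (simp only: T_def smult_add_right smult_smult mult.commute nat.case) (simp split: nat.split)
    qed
  qed
  also have "(\<Sum>k\<le>n. smult (2 * b k) (T k)) = smult (2 * b 0) (T 0) + (\<Sum>k\<le>n. smult (2 * b (Suc k)) (T (Suc k)))"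
    using shift[of "\<lambda>k. smult 2 (T k)"] by (simp add: mult.commute)
  also have "(\<Sum>k\<le>n. smult (b k) (case k of 0 \<Rightarrow> 0 | Suc 0 \<Rightarrow> 2 | Suc (Suc l) \<Rightarrow> T (Suc l)))
     = smult (b 1) 2 + (\<Sum>k\<le>n. smult (b (Suc (Suc k))) (T (Suc k)))"
  proof -
    have "(\<Sum>k\<le>n. smult (b (Suc k)) (case k of 0 \<Rightarrow> 2 | Suc l \<Rightarrow> T (Suc l)))
        = smult (b 1) 2 + (\<Sum>k\<le>n. smult (b (Suc (Suc k))) (T (Suc k)))"
      using sum.atMost_Suc_shift[of "\<lambda>k. smult (b (Suc k)) (case k of 0 \<Rightarrow> 2 | Suc l \<Rightarrow> T (Suc l))" n]
      by (simp add: b0)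
    then show ?thesis by (subst shift) simp
  qed
  finally have "monom 1 (Suc n) = smult (2 * b 0) (T 0) + smult (b 1) 2
      + (\<Sum>k\<le>n. smult (b k + 2 * b (Suc k) + b (Suc (Suc k))) (T (Suc k)))"
    by (simp add: smult_add_left sum.distrib algebra_simps)
  also have "smult (b 1) 2 = smult (2 * b 1) (T 0)"
    by (simp add: T_def cheb_first_simps numeral_poly)
  also have "smult (2 * b 0) (T 0) + \<dots> = smult (2 * b 0 + 2 * b 1) (T 0)"
    by (simp add: smult_add_left)
  finally show ?case
    by (subst sum.atMost_Suc_shift) (simp only: pascal pascal0 T_def[symmetric] add_0_right)
qed

text \<open>
  The expansion of the monomials is triangular with ones on the diagonal, so the moments of
  the monomials determine those of the basis \<open>cheb_first\<close>.
\<close>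

lemma moment_cheb_first:
  assumes "\<And>n. \<mu> n = (\<Sum>k\<le>n. c k * of_nat (2 * n choose (n + k)))"
  shows "moment \<mu> (cheb_first n) = c n"
proof (induction n rule: less_induct)
  case (less n)
  have "\<mu> n = moment \<mu> (monom 1 n)" by simp
  also have "\<dots> = (\<Sum>k\<le>n. of_nat (2 * n choose (n + k)) * moment \<mu> (cheb_first k))"
    by (subst monom_eq_sum_cheb_first) (simp add: moment_sum moment_smult)
  finally have "(\<Sum>k\<le>n. of_nat (2 * n choose (n + k)) * moment \<mu> (cheb_first k))
      = (\<Sum>k\<le>n. of_nat (2 * n choose (n + k)) * c k)"
    by (simp add: assms mult.commute)
  moreover have "(\<Sum>k<n. of_nat (2 * n choose (n + k)) * moment \<mu> (cheb_first k))
      = (\<Sum>k<n. of_nat (2 * n choose (n + k)) * c k)"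
    using less by simp
  ultimately show ?case
    by (simp add: lessThan_Suc_atMost[symmetric] flip: mult_2)
qed

lemma fps_nth_compose_mult:
  fixes f g h :: "'a::comm_ring_1 fps"
  assumes "fps_nth g 0 = 0"
  shows "fps_nth ((f oo g) * h) n = (\<Sum>k\<le>n. fps_nth f k * fps_nth (g ^ k * h) n)"
proof -
  have "fps_nth (f oo g) i = (\<Sum>k\<le>n. fps_nth f k * fps_nth (g ^ k) i)" if "i \<le> n" for i
    unfolding fps_compose_nth atLeast0AtMost
    by (rule sum.mono_neutral_left) (use that assms in \<open>auto simp: startsby_zero_power_prefix\<close>)
  then have "fps_nth ((f oo g) * h) n
      = (\<Sum>i\<le>n. \<Sum>k\<le>n. fps_nth f k * fps_nth (g ^ k) i * fps_nth h (n - i))"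
    by (simp add: fps_mult_nth atLeast0AtMost sum_distrib_right)
  also have "\<dots> = (\<Sum>k\<le>n. fps_nth f k * fps_nth (g ^ k * h) n)"
    by (subst sum.swap) (simp add: fps_mult_nth atLeast0AtMost sum_distrib_left mult.assoc)
  finally show ?thesis .
qed

text \<open>
  Multiplication by \<open>x / (1 - x)\<close> moves each column of Pascal's triangle to the next one.
\<close>

lemma fps_nth_binomial_column:
  "fps_nth ((fps_X / (1 - fps_X)) ^ m * inverse (1 - fps_X) :: 'a::field fps) n = of_nat (n choose m)"
proof -
  define V where "V m = (Abs_fps (\<lambda>n. of_nat (n choose m)) :: 'a fps)" for m
  define y where "y = inverse (1 - fps_X :: 'a fps)"
  have y: "(1 - fps_X) * y = 1"
    unfolding y_def by (simp add: inverse_mult_eq_1')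
  have "(1 - fps_X) * V 0 = 1"
    by (rule fps_ext) (simp add: V_def algebra_simps)
  then have V0: "V 0 = y"
    using y by (metis mult.commute mult.left_commute mult.right_neutral)
  have step: "(1 - fps_X) * V (Suc m) = fps_X * V m" for m
  proof (rule fps_ext)
    fix n show "fps_nth ((1 - fps_X) * V (Suc m)) n = fps_nth (fps_X * V m) n"
      by (cases n) (simp_all add: V_def algebra_simps)
  qed
  have VSuc: "V (Suc m) = fps_X * y * V m" for m
    using step[of m] y by (metis mult.assoc mult.commute mult.left_neutral)
  have "(fps_X * y) ^ m * y = V m"
    by (induction m) (simp_all add: V0 VSuc mult.assoc)
  then show ?thesis
    by (simp add: fps_divide_unit y_def V_def fps_eq_iff)
qed

lemma fps_nth_central_transform:
  fixes g :: "'a::field_char_0 fps"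
  assumes "fps_nth g 0 \<noteq> 0"
  shows "fps_nth (central_transform g) n
    = (\<Sum>k\<le>n. fps_nth (inverse g) k * of_nat (2 * n choose (n + k)))"
proof -
  define u where "u = (fps_X / (1 - fps_X) :: 'a fps)"
  have u0: "fps_nth u 0 = 0" by (simp add: u_def)
  have "1 / ((1 - fps_X) * (g oo u)) * u ^ n = (inverse g oo u) * (u ^ n * inverse (1 - fps_X))"
    using assms u0
    by (simp add: fps_divide_unit fps_inverse_mult fps_inverse_compose mult_ac)
  then have "fps_nth (central_transform g) n
      = fps_nth ((inverse g oo u) * (u ^ n * inverse (1 - fps_X))) (2 * n)"
    by (simp only: central_transform_def u_def fps_nth_Abs_fps)
  also have "\<dots> = (\<Sum>k\<le>2 * n. fps_nth (inverse g) k
      * fps_nth (u ^ (n + k) * inverse (1 - fps_X)) (2 * n))"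
    by (subst fps_nth_compose_mult[OF u0]) (simp add: power_add mult_ac)
  also have "\<dots> = (\<Sum>k\<le>2 * n. fps_nth (inverse g) k * of_nat (2 * n choose (n + k)))"
    unfolding u_def fps_nth_binomial_column ..
  also have "\<dots> = (\<Sum>k\<le>n. fps_nth (inverse g) k * of_nat (2 * n choose (n + k)))"
    by (rule sum.mono_neutral_right) (auto simp: binomial_eq_0)
  finally show ?thesis .
qed

text \<open>
  The moments of \<open>cheb_first\<close> are the coefficients of \<open>1/g\<close>; convolving the polynomials with \<open>g\<close>
  convolves their moments with \<open>g\<close> and gives the coefficients of 1.
\<close>

lemma moment_cheb_times_g:
  fixes g :: "'a::field_char_0 fps"
  assumes "fps_nth g 0 \<noteq> 0"
  shows "moment (fps_nth (central_transform g)) (cheb ((1 - fps_X ^ 2) * g) n) = (if n = 0 then 1 else 0)"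
proof -
  have "moment (fps_nth (central_transform g)) (cheb ((1 - fps_X ^ 2) * g) n)
      = (\<Sum>j\<le>n. fps_nth g j * fps_nth (inverse g) (n - j))"
    using moment_cheb_first[OF fps_nth_central_transform[OF assms]]
    by (simp add: cheb_mult moment_sum moment_smult flip: cheb_first_def)
  also have "\<dots> = fps_nth (g * inverse g) n"
    by (simp add: fps_mult_nth atLeast0AtMost)
  also have "g * inverse g = 1"
    using assms by (rule inverse_mult_eq_1')
  finally show ?thesis by simp
qed

text \<open>
  Multiply \<open>cheb f i * cheb h j\<close> by \<open>t\<close> and expand the result once through the first factor, once
  through the second. Since the members of index 0 are 1, the source terms contribute values with one
  index 0; hence the first column of \<open>G\<close> determines all of \<open>G\<close>.
\<close>

lemma moment_cheb_product_step:
  fixes f h :: "'a::comm_ring_1 fps" and \<mu> :: "nat \<Rightarrow> 'a"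
  defines "G \<equiv> \<lambda>i j. moment \<mu> (cheb f i * cheb h j)"
  assumes "fps_nth f 0 = 1" and "fps_nth h 0 = 1"
  shows "G i (Suc j) = G (Suc i) j + (if i = 0 then 0 else G (i - 1) j)
    - (if j = 0 then 0 else G i (j - 1)) - fps_nth f (Suc i) * G 0 j + fps_nth h (Suc j) * G i 0"
proof -
  have left: "moment \<mu> ([:-2, 1:] * cheb f i * cheb h j) =
      G (Suc i) j + (if i = 0 then 0 else G (i - 1) j) - fps_nth f (Suc i) * G 0 j"
    unfolding mult_cheb G_def using assms(2)
    by (simp add: distrib_right left_diff_distrib moment_add moment_diff moment_smult del: cheb.simps(2))
  have right: "moment \<mu> (cheb f i * ([:-2, 1:] * cheb h j)) =
      G i (Suc j) + (if j = 0 then 0 else G i (j - 1)) - fps_nth h (Suc j) * G i 0"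
    unfolding mult_cheb G_def using assms(3)
    by (simp add: distrib_left right_diff_distrib moment_add moment_diff moment_smult del: cheb.simps(2))
  have "moment \<mu> ([:-2, 1:] * cheb f i * cheb h j) = moment \<mu> (cheb f i * ([:-2, 1:] * cheb h j))"
    by (simp only: mult_ac)
  from trans[OF left[symmetric] trans[OF this right]] show ?thesis
    by (simp only: algebra_simps)
qed

section \<open>The Hankel determinants of the series (1 + a x) / (1 - x^3)\<close>

context
  fixes a :: "'k::field_char_0"
begin

fun lucas_seq :: "nat \<Rightarrow> 'k" where
  "lucas_seq 0 = 0"
| "lucas_seq (Suc 0) = 1"
| "lucas_seq (Suc (Suc n)) = - (a + 1) * lucas_seq (Suc n) - lucas_seq n"

text \<open>
  In the notation of the introductory remarks, the coefficient of index \<open>k \<ge> 1\<close> is \<open>P\<^sub>k(1 - a)\<close>.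
  At \<open>z = 1 - a\<close> one has \<open>t = - (a + 1)\<close>, whence the Lucas sequence. The visible factor \<open>1 - a\<close> cancels
  against the norm \<open>1 / (1 - a)\<close> of the constant polynomial for the Bernstein-Szego weight, so the
  value \<open>a = 1\<close> needs no separate treatment.
\<close>

definition col_source :: "'k fps" where
  "col_source = Abs_fps (\<lambda>j. if j = 0 then 1 else - (1 - a) * lucas_seq (j - 1))"

text \<open>
  The coefficient of index \<open>k \<ge> 1\<close> is \<open>P\<^sub>k(1)\<close>. At \<open>z = 1\<close> the parameter \<open>s\<close> is a primitive cube root of
  unity, which makes these values periodic.
\<close>

definition row_source :: "'k fps" where
  "row_source = (1 - fps_X ^ 2) * g_series a"

lemma g_series_mult: "g_series a * (1 - fps_X ^ 3) = 1 + fps_const a * fps_X"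
  unfolding g_series_def by (rule dvd_div_mult_self) simp

lemma g_series_0: "fps_nth (g_series a) 0 = 1"
  using arg_cong[OF g_series_mult, of "\<lambda>f. fps_nth f 0"] by simp

text \<open>
  Cancelling \<open>1 - x\<close> in \<open>(1 - x^2) (1 + a x) / (1 - x^3)\<close> leaves the denominator \<open>1 + x + x^2\<close>: any
  three consecutive coefficients of index at least 1 have sum 0.
\<close>

lemma row_source_nth:
  shows row_source_0: "fps_nth row_source 0 = 1"
    and row_source_1: "fps_nth row_source 1 = a"
    and row_source_2: "fps_nth row_source (Suc (Suc 0)) = - 1"
    and row_source_rec: "fps_nth row_source (Suc (Suc (Suc i)))
       = - fps_nth row_source (Suc (Suc i)) - fps_nth row_source (Suc i)"
proof -
  have "(1 - fps_X) * (row_source * (1 + fps_X + fps_X ^ 2))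
      = (1 - fps_X ^ 2) * (g_series a * (1 - fps_X ^ 3))"
    unfolding row_source_def by (simp add: algebra_simps power2_eq_square power3_eq_cube)
  also have "\<dots> = (1 - fps_X) * ((1 + fps_X) * (1 + fps_const a * fps_X))"
    unfolding g_series_mult by (simp add: algebra_simps power2_eq_square)
  finally have eq: "row_source * (1 + fps_X + fps_X ^ 2) = (1 + fps_X) * (1 + fps_const a * fps_X)"
    by (subst (asm) mult_left_cancel) (auto simp: fps_eq_iff dest: spec[of _ 0])
  have rec: "fps_nth row_source n + (if n < 1 then 0 else fps_nth row_source (n - 1))
       + (if n < 2 then 0 else fps_nth row_source (n - 2))
     = (if n = 0 then 1 else if n = 1 then a + 1 else if n = 2 then a else 0)" for n
  proof -
    have "fps_nth (row_source * (1 + fps_X + fps_X ^ 2)) n =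
      fps_nth row_source n + (if n < 1 then 0 else fps_nth row_source (n - 1))
       + (if n < 2 then 0 else fps_nth row_source (n - 2))"
      by (simp add: distrib_left fps_X_power_mult_right_nth)
    moreover have "(1 + fps_X) * (1 + fps_const a * fps_X)
      = 1 + fps_const (a + 1) * fps_X + fps_const a * fps_X ^ 2"
      by (simp add: algebra_simps power2_eq_square flip: fps_const_add)
    ultimately show ?thesis using eq by (auto simp: fps_nth_fps_const)
  qed
  show r0: "fps_nth row_source 0 = 1" using rec[of 0] by simp
  show r1: "fps_nth row_source 1 = a" using rec[of 1] r0 by simp
  show "fps_nth row_source (Suc (Suc 0)) = - 1" using rec[of 2] r0 r1
    by (auto simp: numeral_2_eq_2 add_eq_0_iff minus_equation_iff[of _ 1])
  show "fps_nth row_source (Suc (Suc (Suc i)))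
       = - fps_nth row_source (Suc (Suc i)) - fps_nth row_source (Suc i)"
  proof -
    have "fps_nth row_source (Suc (Suc (Suc i))) + fps_nth row_source (Suc (Suc i))
        + fps_nth row_source (Suc i) = 0"
      using rec[of "Suc (Suc (Suc i))"] by (simp add: numeral_2_eq_2)
    then have "fps_nth row_source (Suc (Suc (Suc i)))
        = 0 - fps_nth row_source (Suc (Suc i)) - fps_nth row_source (Suc i)"
      by (simp only: eq_diff_eq)  (simp only: ac_simps)
    then show ?thesis by simp
  qed
qed

lemma col_source_nth:
  "fps_nth col_source 0 = 1" "fps_nth col_source (Suc j) = - (1 - a) * lucas_seq j"
  by (simp_all add: col_source_def)

text \<open>
  The right-hand side has the first column prescribed by \<open>moment_cheb_times_g\<close> and satisfies the
  recurrence of \<open>moment_cheb_product_step\<close>. In the latter, the sum of the two neighbouring rows is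
  governed by the vanishing sums of three consecutive row coefficients, and the next column by
  the recurrence of the Lucas sequence.
\<close>

lemma gram_matrix_rank_one:
  "moment (fps_nth (central_transform (g_series a))) (cheb row_source i * cheb col_source j)
     = (if i = j then 1 else 0) - fps_nth row_source (Suc i) * lucas_seq j"
proof -
  define G where "G i j = moment (fps_nth (central_transform (g_series a)))
    (cheb row_source i * cheb col_source j)" for i j
  define r where "r = fps_nth row_source"
  have r: "r (Suc 0) = a" "r (Suc (Suc 0)) = -1" "r (Suc (Suc (Suc i))) = - r (Suc (Suc i)) - r (Suc i)" for i
    using row_source_1 row_source_2 row_source_rec by (auto simp: r_def)
  have G0: "G i 0 = (if i = 0 then 1 else 0)" for i
    using moment_cheb_times_g[of "g_series a" i] by (simp add: G_def g_series_0 row_source_def col_source_nth)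
  have step: "G i (Suc j) = G (Suc i) j + (if i = 0 then 0 else G (i - 1) j)
    - (if j = 0 then 0 else G i (j - 1)) - r (Suc i) * G 0 j + - (1 - a) * lucas_seq j * G i 0" for i j
    unfolding G_def r_def using moment_cheb_product_step[OF row_source_0 col_source_nth(1)]
    by (simp only: col_source_nth)
  have "G i j = (if i = j then 1 else 0) - r (Suc i) * lucas_seq j"
  proof (induction j arbitrary: i rule: less_induct)
    case (less j)
    consider "j = 0" | "j = 1" | k where "j = Suc (Suc k)"
      by (cases j; cases "j - 1") auto
    then show ?case
    proof cases
      case 1
      then show ?thesis by (simp add: G0)
    next
      case 2
      then show ?thesis using step[of i 0] by (auto simp: G0 r)
    next
      case (3 k)
      have IH: "G i (Suc k) = (if i = Suc k then 1 else 0) - r (Suc i) * lucas_seq (Suc k)"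
         "G i k = (if i = k then 1 else 0) - r (Suc i) * lucas_seq k" for i
        using less[of "Suc k"] less[of k] 3 by auto
      show ?thesis
        unfolding 3 step[of i "Suc k"] by (cases i) (auto simp: IH G0 r algebra_simps)
    qed
  qed
  then show ?thesis by (simp add: G_def r_def)
qed

lemma central_hankel_g_series:
  "central_hankel (g_series a) n = 1 - (\<Sum>i\<le>n. fps_nth row_source (Suc i) * lucas_seq i)"
proof -
  have "central_hankel (g_series a) n
      = det (mat (n + 1) (n + 1) (\<lambda>(i, j). moment (fps_nth (central_transform (g_series a)))
          (cheb row_source i * cheb col_source j)))"
    unfolding central_hankel_def
    by (rule hankel_det_eq_det_monic_bases)
       (simp_all add: degree_cheb_le lead_coeff_cheb row_source_0 col_source_nth)
  also have "\<dots> = 1 - (\<Sum>i<n + 1. fps_nth row_source (Suc i) * lucas_seq i)"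
    unfolding gram_matrix_rank_one by (rule det_identity_minus_rank_one)
  finally show ?thesis by (simp add: lessThan_Suc_atMost)
qed

lemma central_hankel_g_series_Suc:
  "central_hankel (g_series a) (Suc n)
    = central_hankel (g_series a) n - fps_nth row_source (Suc (Suc n)) * lucas_seq (Suc n)"
  by (simp add: central_hankel_g_series)

lemma central_hankel_g_series_initial:
  "central_hankel (g_series a) 0 = 1"
  "central_hankel (g_series a) 1 = 2"
  "central_hankel (g_series a) 2 = 3 - a ^ 2"
  "central_hankel (g_series a) 3 = 3 - 3 * a ^ 2 - a ^ 3"
  using row_source_1
  by (simp_all add: central_hankel_g_series row_source_2 row_source_rec numeral_2_eq_2
      numeral_3_eq_3 algebra_simps)

text \<open>
  The differences \<open>h\<^bsub>n+1\<^esub> - h\<^sub>n\<close> are products of a sequence with characteristic polynomial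
  \<open>x^2 + x + 1\<close> and one with characteristic polynomial \<open>x^2 + (a + 1) x + 1\<close>. The products of a root
  of the first and a root of the second are the roots of
  \<open>x^4 - (a + 1) x^3 + ((a + 1)^2 - 1) x^2 - (a + 1) x + 1\<close>, so the differences satisfy the claimed
  recurrence. For \<open>h\<close> itself the defect of the recurrence is then constant, and it vanishes at the start.
\<close>

lemma central_hankel_g_series_rec:
  "central_hankel (g_series a) (n + 4) = (a + 1) * central_hankel (g_series a) (n + 3)
     - ((a + 1) ^ 2 - 1) * central_hankel (g_series a) (n + 2)
     + (a + 1) * central_hankel (g_series a) (n + 1) - central_hankel (g_series a) n"
proof (induction n)
  case 0
  define h where "h = central_hankel (g_series a)"
  have "h 4 = h 3 - fps_nth row_source (Suc 4) * lucas_seq 4"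
    using central_hankel_g_series_Suc[of 3] by (simp add: h_def numeral_eq_Suc)
  also have "\<dots> = h 3 + (2 * (a + 1) - (a + 1) ^ 3)"
    using row_source_1 by (simp add: row_source_2 row_source_rec numeral_eq_Suc algebra_simps power_Suc)
  finally have "h 4 = (a + 1) * h 3 - ((a + 1) ^ 2 - 1) * h 2 + (a + 1) * h 1 - h 0"
    unfolding h_def central_hankel_g_series_initial
    by (simp add: power2_eq_square power3_eq_cube algebra_simps)
  then show ?case
    by (simp add: h_def del: add_2_eq_Suc')
next
  case (Suc n)
  define h where "h = central_hankel (g_series a)"
  define r where "r k = fps_nth row_source (Suc (Suc (n + k)))" for k
  define v where "v k = lucas_seq (Suc (n + k))" for k
  have h: "h (n + 1) = h n - r 0 * v 0" "h (n + 2) = h (n + 1) - r 1 * v 1"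
    "h (n + 3) = h (n + 2) - r 2 * v 2" "h (n + 4) = h (n + 3) - r 3 * v 3"
    "h (n + 5) = h (n + 4) - r 4 * v 4"
    using central_hankel_g_series_Suc[of n] central_hankel_g_series_Suc[of "n + 1"]
      central_hankel_g_series_Suc[of "n + 2"] central_hankel_g_series_Suc[of "n + 3"]
      central_hankel_g_series_Suc[of "n + 4"]
    by (simp_all add: h_def r_def v_def numeral_eq_Suc)
  have r: "r 2 = - r 1 - r 0" "r 3 = - r 2 - r 1" "r 4 = - r 3 - r 2"
    by (simp_all add: r_def row_source_rec numeral_eq_Suc)
  have v: "v 2 = - (a + 1) * v 1 - v 0" "v 3 = - (a + 1) * v 2 - v 1" "v 4 = - (a + 1) * v 3 - v 2"
    by (simp_all add: v_def numeral_eq_Suc)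
  define q where "q = (a + 1) ^ 2 - 1"
  have w: "r 4 * v 4 = (a + 1) * (r 3 * v 3) - q * (r 2 * v 2) + (a + 1) * (r 1 * v 1) - r 0 * v 0"
    unfolding r v q_def by (simp add: algebra_simps power2_eq_square)
  have "h (n + 4) = (a + 1) * h (n + 3) - q * h (n + 2) + (a + 1) * h (n + 1) - h n"
    using Suc by (simp add: h_def q_def)
  then have "h (n + 5) = (a + 1) * (h (n + 3) - r 3 * v 3) - q * (h (n + 2) - r 2 * v 2)
      + (a + 1) * (h (n + 1) - r 1 * v 1) - (h n - r 0 * v 0)"
    unfolding h(5) w by (simp add: algebra_simps)
  then have "h (n + 5) = (a + 1) * h (n + 4) - q * h (n + 3) + (a + 1) * h (n + 2) - h (n + 1)"
    by (simp only: h(1-4)[symmetric])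
  then show ?case by (simp add: h_def q_def numeral_eq_Suc)
qed

end

section \<open>The generating function\<close>

lemma fps_of_linear_recurrence_order_4:
  fixes h :: "nat \<Rightarrow> 'a::field"
  assumes rec: "\<And>n. h (n + 4) = p * h (n + 3) - q * h (n + 2) + r * h (n + 1) - s * h n"
  shows "Abs_fps h =
    (fps_const (h 0) + fps_const (h 1 - p * h 0) * fps_X
       + fps_const (h 2 - p * h 1 + q * h 0) * fps_X ^ 2
       + fps_const (h 3 - p * h 2 + q * h 1 - r * h 0) * fps_X ^ 3) /
    (1 - fps_const p * fps_X + fps_const q * fps_X ^ 2 - fps_const r * fps_X ^ 3
       + fps_const s * fps_X ^ 4)" (is "_ = ?N / ?D")
proof -
  have D0: "fps_nth ?D 0 = 1" by simp
  have "Abs_fps h * ?D = ?N"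
  proof (rule fps_ext)
    fix n :: nat
    have expand: "Abs_fps h * ?D = Abs_fps h - fps_const p * (fps_X * Abs_fps h)
        + fps_const q * (fps_X ^ 2 * Abs_fps h) - fps_const r * (fps_X ^ 3 * Abs_fps h)
        + fps_const s * (fps_X ^ 4 * Abs_fps h)"
      by (simp add: algebra_simps)
    consider "n = 0" | "n = 1" | "n = 2" | "n = 3" | m where "n = m + 4"
    proof -
      have "n = 0 \<or> n = 1 \<or> n = 2 \<or> n = 3 \<or> (\<exists>m. n = m + 4)" by presburger
      then show ?thesis using that by blast
    qed
    then show "fps_nth (Abs_fps h * ?D) n = fps_nth ?N n"
    proof cases
      case (5 m)
      then show ?thesis unfolding expand using rec[of m]
        by (simp add: fps_X_power_mult_nth add.commute)
    qed (simp_all add: expand fps_X_power_mult_nth)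
  qed
  then show ?thesis
    using D0 by (metis nonzero_mult_div_cancel_right fps_zero_nth zero_neq_one)
qed

theorem theorem1p7:
  fixes a :: "'k::field_char_0"
  defines "h \<equiv> central_hankel (g_series a)"
  shows
    "central_hankel_series (g_series a) =
       (1 + fps_const (1 - a) * fps_X + fps_X ^ 2 - fps_X ^ 3) /
       (1 - fps_const (a + 1) * fps_X + fps_const ((a + 1) ^ 2 - 1) * fps_X ^ 2
          - fps_const (a + 1) * fps_X ^ 3 + fps_X ^ 4)
     \<and> (h 0 = 1 \<and> h 1 = 2 \<and> h 2 = 3 - a ^ 2 \<and> h 3 = 3 - 3 * a ^ 2 - a ^ 3
        \<and> (\<forall>n\<ge>4. h n = (a + 1) * h (n - 1) - ((a + 1) ^ 2 - 1) * h (n - 2)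
                          + (a + 1) * h (n - 3) - h (n - 4)))"
proof -
  have init: "h 0 = 1" "h 1 = 2" "h 2 = 3 - a ^ 2" "h 3 = 3 - 3 * a ^ 2 - a ^ 3"
    unfolding h_def by (fact central_hankel_g_series_initial)+
  have rec: "h (n + 4) = (a + 1) * h (n + 3) - ((a + 1) ^ 2 - 1) * h (n + 2)
      + (a + 1) * h (n + 1) - 1 * h n" for n
    unfolding h_def using central_hankel_g_series_rec[of a n] by simp
  have numerator: "h 1 - (a + 1) * h 0 = 1 - a"
    "h 2 - (a + 1) * h 1 + ((a + 1) ^ 2 - 1) * h 0 = 1"
    "h 3 - (a + 1) * h 2 + ((a + 1) ^ 2 - 1) * h 1 - (a + 1) * h 0 = - 1"
    unfolding init by (simp_all add: power2_eq_square power3_eq_cube algebra_simps)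
  have "central_hankel_series (g_series a) = Abs_fps h"
    by (simp add: central_hankel_series_def h_def)
  also have "\<dots> =
       (1 + fps_const (1 - a) * fps_X + fps_X ^ 2 - fps_X ^ 3) /
       (1 - fps_const (a + 1) * fps_X + fps_const ((a + 1) ^ 2 - 1) * fps_X ^ 2
          - fps_const (a + 1) * fps_X ^ 3 + fps_X ^ 4)"
    unfolding fps_of_linear_recurrence_order_4[of h, OF rec] numerator
    by (simp add: init(1) flip: fps_const_neg)
  finally have series: "central_hankel_series (g_series a) =
       (1 + fps_const (1 - a) * fps_X + fps_X ^ 2 - fps_X ^ 3) /
       (1 - fps_const (a + 1) * fps_X + fps_const ((a + 1) ^ 2 - 1) * fps_X ^ 2
          - fps_const (a + 1) * fps_X ^ 3 + fps_X ^ 4)" .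
  have "h n = (a + 1) * h (n - 1) - ((a + 1) ^ 2 - 1) * h (n - 2)
      + (a + 1) * h (n - 3) - h (n - 4)" if "n \<ge> 4" for n
  proof -
    from that obtain m where "n = m + 4" using le_Suc_ex by (metis add.commute)
    then show ?thesis using rec[of m] by (simp add: add.commute)
  qed
  with series init show ?thesis by blast
qed

end
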